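(* Let $S\subset\mathbb{R}^n$ be compact and convex, and let $a^i,c^i\in\mathbb{R}^n$, $g_i,h_i\in\mathbb{R}$ ($i=1,\ldots,m$) satisfy $(c^i)^Tx+h_i>0$ for all $x\in S$ and all $i=1,\ldots,m$. Let $\|\cdot\|$ be a norm on $\mathbb{R}^n$ and $\delta>0$. For $x\in S$ define $$\tilde f(x):=\max_{y\in S,\ \|y-x\|\le\delta}\ \max_{i=1,\ldots,m}\frac{(a^i)^Ty+g_i}{(c^i)^Ty+h_i},$$ and, for $i=1,\ldots,m$, consider the problem $$(\mathrm{F}_{i,x})\qquad \tilde f_i(x):=\max_{y}\ \left\{\frac{(a^i)^Ty+g_i}{(c^i)^Ty+h_i}\ :\ \|y-x\|\le\delta,\ y\in S\right\}.$$ If $x\in S$, then $\tilde f(x)=\max_{i=1,\ldots,m}\tilde f_i(x)$, where for $i=1,\ldots,m$, $\tilde f_i(x)$ is the optimal objective function value of the following convex optimization problem: $$P_i(x):\qquad \begin{array}{ll}\max\limits_{\bar y,\theta} & (a^i)^T\bar y+g_i\theta\\ \text{s.t.} & \|\bar y-\theta x\|\le\theta\delta,\\ & (c^i)^T\bar y+h_i\theta=1,\\ & \bar y\in\theta S,\\ & \theta\ge0,\end{array}$$ with variables $\bar y\in\mathbb{R}^n$, $\theta\in\mathbb{R}$. For each $i=1,\ldots,m$, if $(\bar y,\theta)$ is feasible for $P_i(x)$, then $y=\bar y/\theta$ is feasible for $(\mathrm{F}_{i,x})$; and if $(\bar y,\theta)$ is optimal for $P_i(x)$, then $y=\bar y/\theta$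 is optimal for $(\mathrm{F}_{i,x})$.
   Context: For $\theta\ge0$, $\theta S:=\{\theta s: s\in S\}$ denotes the scaling of $S$ by $\theta$; for $\theta=0$, $\theta S=\{0\}$. *)

theory Defs
  imports "HOL-Analysis.Analysis"
begin

text \<open>
  The type class norm on \<^typ>\<open>real ^ 'n\<close> is the Euclidean one; an arbitrary norm on the
  space is a function satisfying the norm axioms.
\<close>

definition is_norm :: "('v::real_vector \<Rightarrow> real) \<Rightarrow> bool" where
  "is_norm N \<longleftrightarrow>
     (\<forall>v. 0 \<le> N v) \<and>
     (\<forall>v. N v = 0 \<longleftrightarrow> v = 0) \<and>
     (\<forall>r v. N (r *\<^sub>R v) = \<bar>r\<bar> * N v) \<and>
     (\<forall>v w. N (v + w) \<le> N v + N w)"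

abbreviation optimal_solution :: "('v \<Rightarrow> real) \<Rightarrow> 'v set \<Rightarrow> 'v \<Rightarrow> bool" where
  "optimal_solution f A z \<equiv> is_arg_max f (\<lambda>y. y \<in> A) z"

text \<open>
  The maximum of \<open>f\<close> over a possibly infinite set. Its value is only meaningful when
  \<open>optimal_solution f A\<close> holds for some point.
\<close>

definition maximum :: "('v \<Rightarrow> real) \<Rightarrow> 'v set \<Rightarrow> real" where
  "maximum f A = (GREATEST v. v \<in> f ` A)"

definition convex_max_problem :: "('v::real_vector \<Rightarrow> real) \<Rightarrow> 'v set \<Rightarrow> bool" where
  "convex_max_problem f A \<longleftrightarrow> convex A \<and> concave_on A f"

definition linear_fraction ::
  "real ^ 'n \<Rightarrow> real \<Rightarrow> real ^ 'n \<Rightarrow> real \<Rightarrow> real ^ 'n \<Rightarrow> real" where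
  "linear_fraction a g c h y = (a \<bullet> y + g) / (c \<bullet> y + h)"

definition F_feasible ::
  "(real ^ 'n \<Rightarrow> real) \<Rightarrow> real \<Rightarrow> (real ^ 'n) set \<Rightarrow> real ^ 'n \<Rightarrow> (real ^ 'n) set" where
  "F_feasible N \<delta> S x = {y \<in> S. N (y - x) \<le> \<delta>}"

definition P_objective :: "real ^ 'n \<Rightarrow> real \<Rightarrow> (real ^ 'n) \<times> real \<Rightarrow> real" where
  "P_objective a g = (\<lambda>(yb, \<theta>). a \<bullet> yb + g * \<theta>)"

text \<open>
  The scaling of \<open>S\<close> by \<open>\<theta>\<close> is the image of \<open>S\<close>; for \<open>\<theta> = 0\<close> it is \<open>{0}\<close> as soon as \<open>S\<close>
  is nonempty.
\<close>

definition P_feasible ::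
  "(real ^ 'n \<Rightarrow> real) \<Rightarrow> real \<Rightarrow> (real ^ 'n) set \<Rightarrow> real ^ 'n \<Rightarrow> real \<Rightarrow> real ^ 'n
     \<Rightarrow> ((real ^ 'n) \<times> real) set" where
  "P_feasible N \<delta> S c h x =
     {(yb, \<theta>). N (yb - \<theta> *\<^sub>R x) \<le> \<theta> * \<delta> \<and> c \<bullet> yb + h * \<theta> = 1 \<and>
               yb \<in> (\<lambda>s. \<theta> *\<^sub>R s) ` S \<and> 0 \<le> \<theta>}"

definition max_fraction ::
  "nat \<Rightarrow> (nat \<Rightarrow> real ^ 'n) \<Rightarrow> (nat \<Rightarrow> real) \<Rightarrow> (nat \<Rightarrow> real ^ 'n) \<Rightarrow> (nat \<Rightarrow> real)
     \<Rightarrow> real ^ 'n \<Rightarrow> real" where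
  "max_fraction m a g c h y = Max ((\<lambda>i. linear_fraction (a i) (g i) (c i) (h i) y) ` {1..m})"

definition f_tilde ::
  "(real ^ 'n \<Rightarrow> real) \<Rightarrow> real \<Rightarrow> (real ^ 'n) set \<Rightarrow> nat \<Rightarrow> (nat \<Rightarrow> real ^ 'n) \<Rightarrow> (nat \<Rightarrow> real)
     \<Rightarrow> (nat \<Rightarrow> real ^ 'n) \<Rightarrow> (nat \<Rightarrow> real) \<Rightarrow> real ^ 'n \<Rightarrow> real" where
  "f_tilde N \<delta> S m a g c h x = maximum (max_fraction m a g c h) (F_feasible N \<delta> S x)"

definition f_tilde_i ::
  "(real ^ 'n \<Rightarrow> real) \<Rightarrow> real \<Rightarrow> (real ^ 'n) set \<Rightarrow> real ^ 'n \<Rightarrow> real \<Rightarrow> real ^ 'n \<Rightarrow> real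
     \<Rightarrow> real ^ 'n \<Rightarrow> real" where
  "f_tilde_i N \<delta> S a g c h x = maximum (linear_fraction a g c h) (F_feasible N \<delta> S x)"

end

theory Submission
  imports Defs
begin

text \<open>
  Three facts carry the result.

  A norm on a finite-dimensional space is convex, hence continuous, so the points of \<open>S\<close> within
  distance \<open>\<delta>\<close> of \<open>x\<close> form a nonempty compact convex set, on which every fraction attains its
  maximum (\<open>linear_fraction_attains_max\<close>). A maximum over finitely many \<open>i\<close> and a maximum over
  \<open>y\<close> commute (\<open>maximum_Max\<close>), which gives the formula for \<^const>\<open>f_tilde\<close>.

  The reformulation is the Charnes--Cooper substitution: rescale \<open>y\<close> by
  \<open>\<theta> = 1 / (c \<bullet> y + h)\<close>, so that the denominator is normalized to \<open>1\<close> and the fraction becomes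
  the linear function \<open>a \<bullet> yb + g * \<theta>\<close>. The two facts that matter are that the feasible set of
  the new problem is exactly the image of the old one (\<open>P_feasible_eq_image\<close>) and that objective
  values are preserved (\<open>P_objective_charnes_cooper\<close>). Maxima and maximizers then transfer in both
  directions with no further computation, and \<open>yb /\<^sub>R \<theta>\<close> recovers the preimage. The case
  \<open>\<theta> = 0\<close> would force \<open>yb = 0\<close>, contradicting the normalization.

  The image is convex although the substitution is not affine: it is the slice
  \<open>c \<bullet> yb + h * \<theta> = 1\<close> of the cone over the old feasible set placed at height \<open>1\<close>
  (\<open>charnes_cooper_image_eq_cone_slice\<close>).
\<close>

section \<open>Attained maxima\<close>

lemma maximum_eq_optimal_value:
  assumes "optimal_solution f A z"
  shows "maximum f A = f z"
  unfolding maximum_def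
  using assms by (intro Greatest_equality) (auto simp: is_arg_max_def not_less)

lemma optimal_solution_iff: "optimal_solution f A z \<longleftrightarrow> z \<in> A \<and> (\<forall>y\<in>A. f y \<le> (f z :: real))"
  by (auto simp: is_arg_max_def not_less)

lemma maximum_image: "maximum f (\<phi> ` A) = maximum (f \<circ> \<phi>) A"
  by (simp add: maximum_def image_comp)

lemma optimal_solution_image:
  fixes f :: "'b \<Rightarrow> real"
  assumes "y \<in> A"
  shows "optimal_solution f (\<phi> ` A) (\<phi> y) \<longleftrightarrow> optimal_solution (f \<circ> \<phi>) A y"
  using assms by (auto simp: optimal_solution_iff)

text \<open>
  A maximizer of the pointwise maximum is a maximizer of that \<open>f i\<close> whose optimal value is largest.
\<close>

lemma
  fixes f :: "'i \<Rightarrow> 'v \<Rightarrow> real"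
  assumes "finite I" "I \<noteq> {}" and att: "\<And>i. i \<in> I \<Longrightarrow> \<exists>y. optimal_solution (f i) A y"
  shows optimal_solution_Max: "\<exists>y. optimal_solution (\<lambda>y. Max ((\<lambda>i. f i y) ` I)) A y"
    and maximum_Max:
      "maximum (\<lambda>y. Max ((\<lambda>i. f i y) ` I)) A = Max ((\<lambda>i. maximum (f i) A) ` I)"
proof -
  obtain k where k: "k \<in> I" and top: "maximum (f k) A = Max ((\<lambda>i. maximum (f i) A) ` I)"
    using Max_in[of "(\<lambda>i. maximum (f i) A) ` I"] assms(1,2)
    by (metis (no_types, lifting) finite_imageI image_iff image_is_empty)
  obtain z where z: "optimal_solution (f k) A z"
    using att k by blast
  let ?M = "\<lambda>y. Max ((\<lambda>i. f i y) ` I)"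
  have le: "f i y \<le> f k z" if "i \<in> I" "y \<in> A" for i y
  proof -
    obtain w where w: "optimal_solution (f i) A w"
      using att[OF \<open>i \<in> I\<close>] by blast
    then have "f i y \<le> maximum (f i) A"
      using \<open>y \<in> A\<close> unfolding maximum_eq_optimal_value[OF w]
      by (simp add: optimal_solution_iff)
    also have "\<dots> \<le> maximum (f k) A"
      unfolding top using assms that by simp
    finally show ?thesis
      by (simp add: maximum_eq_optimal_value[OF z])
  qed
  have zA: "z \<in> A"
    using z by (simp add: optimal_solution_iff)
  have Mz: "?M z = f k z"
    using assms k zA le by (intro Max_eqI) auto
  have opt: "optimal_solution ?M A z"
    unfolding optimal_solution_iff Mz using assms zA le by simp
  then show "\<exists>y. optimal_solution ?M A y" ..
  show "maximum ?M A = Max ((\<lambda>i. maximum (f i) A) ` I)"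
    using maximum_eq_optimal_value[OF opt] maximum_eq_optimal_value[OF z] Mz top by simp
qed

section \<open>The feasible set of the fractional problem\<close>

lemma is_norm_convex_on:
  assumes "is_norm N"
  shows "convex_on UNIV N"
proof (rule convex_onI)
  fix t :: real and u v
  assume "0 < t" "t < 1"
  then have "N ((1 - t) *\<^sub>R u) = (1 - t) * N u" "N (t *\<^sub>R v) = t * N v"
    using assms by (simp_all add: is_norm_def)
  moreover have "N ((1 - t) *\<^sub>R u + t *\<^sub>R v) \<le> N ((1 - t) *\<^sub>R u) + N (t *\<^sub>R v)"
    using assms unfolding is_norm_def by blast
  ultimately show "N ((1 - t) *\<^sub>R u + t *\<^sub>R v) \<le> (1 - t) * N u + t * N v"
    by simp
qed simp

lemma is_norm_continuous_on:
  fixes N :: "'v::euclidean_space \<Rightarrow> real"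
  assumes "is_norm N"
  shows "continuous_on A N"
  using convex_on_continuous[OF open_UNIV is_norm_convex_on[OF assms]] continuous_on_subset by blast

lemma F_feasible_eq: "F_feasible N \<delta> S x = S \<inter> (+) x ` {v. N v \<le> \<delta>}"
proof -
  have "y \<in> (+) x ` {v. N v \<le> \<delta>} \<longleftrightarrow> N (y - x) \<le> \<delta>" for y
    by (auto intro: image_eqI[of _ _ "y - x"])
  then show ?thesis
    by (auto simp: F_feasible_def)
qed

lemma compact_F_feasible:
  assumes "compact S" "is_norm N"
  shows "compact (F_feasible N \<delta> S x)"
proof -
  have "closed {v. N v \<le> \<delta>}"
    by (intro closed_Collect_le continuous_intros is_norm_continuous_on assms)
  then show ?thesis
    unfolding F_feasible_eq using assms by (intro compact_Int_closed closed_translation)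
qed

lemma convex_F_feasible:
  assumes "convex S" "is_norm N"
  shows "convex (F_feasible N \<delta> S x)"
proof -
  have "convex {v. N v \<le> \<delta>}"
    using convex_lower[OF is_norm_convex_on[OF assms(2)]]
    by (fastforce intro!: convexI elim: order_trans)
  then show ?thesis
    unfolding F_feasible_eq using assms by (intro convex_Int convex_translation)
qed

lemma linear_fraction_attains_max:
  assumes "compact S" "is_norm N" "0 \<le> \<delta>" "x \<in> S" and pos: "\<forall>z\<in>S. 0 < c \<bullet> z + h"
  shows "\<exists>y. optimal_solution (linear_fraction a g c h) (F_feasible N \<delta> S x) y"
proof -
  have "N 0 = 0"
    using assms by (simp add: is_norm_def)
  then have "x \<in> F_feasible N \<delta> S x"
    using assms by (simp add: F_feasible_def)
  moreover have "\<forall>y \<in> F_feasible N \<delta> S x. c \<bullet> y + h \<noteq> 0"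
    using pos by (force simp: F_feasible_def)
  then have "continuous_on (F_feasible N \<delta> S x) (linear_fraction a g c h)"
    unfolding linear_fraction_def by (intro continuous_intros)
  ultimately show ?thesis
    using continuous_attains_sup[OF compact_F_feasible[OF assms(1,2), of \<delta> x],
        of "linear_fraction a g c h"]
    by (auto simp: optimal_solution_iff)
qed

section \<open>The Charnes--Cooper substitution\<close>

text \<open>
  The homogeneous coordinates \<open>(y, 1)\<close> of \<open>y\<close>, rescaled to meet the normalization.
\<close>

definition charnes_cooper :: "real ^ 'n \<Rightarrow> real \<Rightarrow> real ^ 'n \<Rightarrow> (real ^ 'n) \<times> real" where
  "charnes_cooper c h y = inverse (c \<bullet> y + h) *\<^sub>R (y, 1)"

lemma P_objective_charnes_cooper: "P_objective a g \<circ> charnes_cooper c h = linear_fraction a g c h"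
  by (rule ext)
    (simp add: P_objective_def charnes_cooper_def linear_fraction_def divide_inverse distrib_right)

text \<open>
  The substitution is the central projection of the hyperplane at height \<open>1\<close> onto the hyperplane
  \<open>c \<bullet> yb + h * \<theta> = 1\<close>; each ray over \<open>T\<close> meets the latter exactly once, because
  \<open>c \<bullet> y + h\<close> is positive on \<open>T\<close>.
\<close>

lemma charnes_cooper_image_eq_cone_slice:
  assumes pos: "\<forall>y\<in>T. 0 < c \<bullet> y + h"
  shows "charnes_cooper c h ` T = cone hull (T \<times> {1}) \<inter> {p. (c, h) \<bullet> p = 1}"
proof (intro set_eqI iffI)
  fix p assume "p \<in> charnes_cooper c h ` T"
  then obtain y where y: "y \<in> T" "p = inverse (c \<bullet> y + h) *\<^sub>R (y, 1)"
    by (auto simp: charnes_cooper_def)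
  then have cy: "0 < c \<bullet> y + h"
    using pos by blast
  then have "(c, h) \<bullet> p = 1"
    unfolding y by (simp add: inner_Pair mult.commute[of h] flip: distrib_left)
  moreover have "p \<in> cone hull (T \<times> {1})"
    unfolding cone_hull_expl mem_Collect_eq y(2) using y(1) cy
    by (intro exI[of _ "inverse (c \<bullet> y + h)"] exI[of _ "(y, 1)"]) simp
  ultimately show "p \<in> cone hull (T \<times> {1}) \<inter> {p. (c, h) \<bullet> p = 1}"
    by simp
next
  fix p assume "p \<in> cone hull (T \<times> {1}) \<inter> {p. (c, h) \<bullet> p = 1}"
  then obtain \<theta> y where y: "y \<in> T" "p = \<theta> *\<^sub>R (y, 1)" and "(c, h) \<bullet> p = 1"
    by (auto simp: cone_hull_expl)
  then have "\<theta> * (c \<bullet> y + h) = 1"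
    by (simp add: algebra_simps)
  then have "\<theta> = inverse (c \<bullet> y + h)"
    by (metis inverse_unique mult.commute)
  then show "p \<in> charnes_cooper c h ` T"
    using y by (auto simp: charnes_cooper_def)
qed

text \<open>
  Because a norm is homogeneous, the constraint \<open>N (yb - \<theta> *\<^sub>R x) \<le> \<theta> * \<delta>\<close> is the original one
  multiplied by \<open>\<theta>\<close>, and \<open>\<theta> > 0\<close> is forced by the normalization.
\<close>

lemma P_feasible_eq_image:
  assumes "is_norm N" and pos: "\<forall>z\<in>S. 0 < c \<bullet> z + h"
  shows "P_feasible N \<delta> S c h x = charnes_cooper c h ` F_feasible N \<delta> S x"
proof -
  have scale: "N (\<theta> *\<^sub>R s - \<theta> *\<^sub>R x) \<le> \<theta> * \<delta> \<longleftrightarrow> N (s - x) \<le> \<delta>" if "0 < \<theta>" for \<theta> s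
  proof -
    have "N (\<theta> *\<^sub>R s - \<theta> *\<^sub>R x) = \<theta> * N (s - x)"
      using assms(1) that by (simp add: is_norm_def flip: scaleR_diff_right)
    then show ?thesis
      using that by simp
  qed
  show ?thesis
  proof (intro set_eqI iffI)
    fix p assume "p \<in> P_feasible N \<delta> S c h x"
    then obtain \<theta> s where p: "p = (\<theta> *\<^sub>R s, \<theta>)" and s: "s \<in> S"
      and near: "N (\<theta> *\<^sub>R s - \<theta> *\<^sub>R x) \<le> \<theta> * \<delta>"
      and one: "\<theta> * (c \<bullet> s + h) = 1" and "0 \<le> \<theta>"
      unfolding P_feasible_def by (force simp: distrib_left mult.commute)
    then have "0 < \<theta>"
      by (cases "\<theta> = 0") auto
    then have "s \<in> F_feasible N \<delta> S x"
      using s near scale by (simp add: F_feasible_def)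
    moreover have "\<theta> = inverse (c \<bullet> s + h)"
      using one by (metis inverse_unique mult.commute)
    then have "p = charnes_cooper c h s"
      by (simp add: p charnes_cooper_def)
    ultimately show "p \<in> charnes_cooper c h ` F_feasible N \<delta> S x"
      by blast
  next
    fix p assume "p \<in> charnes_cooper c h ` F_feasible N \<delta> S x"
    then obtain y where y: "y \<in> S" "N (y - x) \<le> \<delta>" and p: "p = charnes_cooper c h y"
      by (auto simp: F_feasible_def)
    define \<theta> where "\<theta> = inverse (c \<bullet> y + h)"
    have cy: "0 < c \<bullet> y + h"
      using pos y by blast
    then have "0 < \<theta>" "\<theta> * (c \<bullet> y + h) = 1"
      by (simp_all add: \<theta>_def)
    moreover have "p = (\<theta> *\<^sub>R y, \<theta>)"
      by (simp add: p charnes_cooper_def \<theta>_def)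
    ultimately show "p \<in> P_feasible N \<delta> S c h x"
      using y scale by (auto simp: P_feasible_def distrib_left mult.commute[of h])
  qed
qed

lemma convex_max_problem_P:
  assumes "convex S" "is_norm N" "\<forall>z\<in>S. 0 < c \<bullet> z + h"
  shows "convex_max_problem (P_objective a g) (P_feasible N \<delta> S c h x)"
proof -
  have "\<forall>y\<in>F_feasible N \<delta> S x. 0 < c \<bullet> y + h"
    using assms by (simp add: F_feasible_def)
  moreover have "convex (cone hull (F_feasible N \<delta> S x \<times> {1::real}))"
    using assms by (intro convex_cone_hull convex_Times convex_F_feasible) simp_all
  ultimately have cvx: "convex (P_feasible N \<delta> S c h x)"
    using assms by (simp add: P_feasible_eq_image charnes_cooper_image_eq_cone_slice
        convex_Int convex_hyperplane)
  have "P_objective a g = (\<lambda>p. (a, g) \<bullet> p)"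
    by (auto simp: P_objective_def)
  then have "concave_on (P_feasible N \<delta> S c h x) (P_objective a g)"
    using cvx by (simp add: concave_on_iff inner_add_right)
  with cvx show ?thesis
    by (simp add: convex_max_problem_def)
qed

text \<open>Dividing by the second component inverts the substitution.\<close>

lemma P_feasibleE:
  assumes "is_norm N" and pos: "\<forall>z\<in>S. 0 < c \<bullet> z + h"
    and "(yb, \<theta>) \<in> P_feasible N \<delta> S c h x"
  shows "0 < \<theta>" "yb /\<^sub>R \<theta> \<in> F_feasible N \<delta> S x" "charnes_cooper c h (yb /\<^sub>R \<theta>) = (yb, \<theta>)"
proof -
  obtain y where y: "y \<in> F_feasible N \<delta> S x" and p: "(yb, \<theta>) = charnes_cooper c h y"
    using assms(3) unfolding P_feasible_eq_image[OF assms(1,2)] by blast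
  have "0 < c \<bullet> y + h"
    using pos y by (simp add: F_feasible_def)
  then show "0 < \<theta>"
    using p by (simp add: charnes_cooper_def)
  then have "yb /\<^sub>R \<theta> = y"
    using p by (simp add: charnes_cooper_def)
  then show "yb /\<^sub>R \<theta> \<in> F_feasible N \<delta> S x" "charnes_cooper c h (yb /\<^sub>R \<theta>) = (yb, \<theta>)"
    using y p by simp_all
qed

section \<open>The equivalence of the two problems\<close>

theorem proposition7:
  fixes S :: "(real ^ 'n) set"
    and a c :: "nat \<Rightarrow> real ^ 'n"
    and g h :: "nat \<Rightarrow> real"
    and m :: nat
    and N :: "real ^ 'n \<Rightarrow> real"
    and \<delta> :: real
    and x :: "real ^ 'n"
  assumes "compact S" and "convex S"
    and "1 \<le> m"
    and "\<forall>i\<in>{1..m}. \<forall>z\<in>S. c i \<bullet> z + h i > 0"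
    and "is_norm N" and "\<delta> > 0"
    and "x \<in> S"
  shows
    "(\<exists>y. optimal_solution (max_fraction m a g c h) (F_feasible N \<delta> S x) y) \<and>
     f_tilde N \<delta> S m a g c h x
       = Max ((\<lambda>i. f_tilde_i N \<delta> S (a i) (g i) (c i) (h i) x) ` {1..m}) \<and>
     (\<forall>i\<in>{1..m}.
        (\<exists>y. optimal_solution (linear_fraction (a i) (g i) (c i) (h i)) (F_feasible N \<delta> S x) y) \<and>
        convex_max_problem (P_objective (a i) (g i)) (P_feasible N \<delta> S (c i) (h i) x) \<and>
        (\<exists>z. optimal_solution (P_objective (a i) (g i)) (P_feasible N \<delta> S (c i) (h i) x) z) \<and>
        f_tilde_i N \<delta> S (a i) (g i) (c i) (h i) x
          = maximum (P_objective (a i) (g i)) (P_feasible N \<delta> S (c i) (h i) x) \<and>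
        (\<forall>yb \<theta>. (yb, \<theta>) \<in> P_feasible N \<delta> S (c i) (h i) x \<longrightarrow>
           \<theta> > 0 \<and> yb /\<^sub>R \<theta> \<in> F_feasible N \<delta> S x) \<and>
        (\<forall>yb \<theta>. optimal_solution (P_objective (a i) (g i)) (P_feasible N \<delta> S (c i) (h i) x) (yb, \<theta>)
           \<longrightarrow> optimal_solution (linear_fraction (a i) (g i) (c i) (h i)) (F_feasible N \<delta> S x)
                 (yb /\<^sub>R \<theta>)))"
proof -
  let ?F = "F_feasible N \<delta> S x"
  let ?f = "\<lambda>i. linear_fraction (a i) (g i) (c i) (h i)"
  have pos: "\<forall>z\<in>S. 0 < c i \<bullet> z + h i" if "i \<in> {1..m}" for i
    using assms(4) that by blast
  have att: "\<exists>y. optimal_solution (?f i) ?F y" if "i \<in> {1..m}" for i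
    using assms pos[OF that] by (intro linear_fraction_attains_max) simp_all
  have ne: "{1..m} \<noteq> {}"
    using assms(3) by simp
  have maxf: "max_fraction m a g c h = (\<lambda>y. Max ((\<lambda>i. ?f i y) ` {1..m}))"
    by (rule ext) (simp add: max_fraction_def)
  have "\<exists>y. optimal_solution (max_fraction m a g c h) ?F y"
    unfolding maxf by (rule optimal_solution_Max[OF finite_atLeastAtMost ne att])
  moreover have "f_tilde N \<delta> S m a g c h x
      = Max ((\<lambda>i. f_tilde_i N \<delta> S (a i) (g i) (c i) (h i) x) ` {1..m})"
    unfolding f_tilde_def f_tilde_i_def maxf
    by (rule maximum_Max[OF finite_atLeastAtMost ne att])
  moreover have "(\<exists>y. optimal_solution (?f i) ?F y) \<and>
        convex_max_problem (P_objective (a i) (g i)) (P_feasible N \<delta> S (c i) (h i) x) \<and>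
        (\<exists>z. optimal_solution (P_objective (a i) (g i)) (P_feasible N \<delta> S (c i) (h i) x) z) \<and>
        f_tilde_i N \<delta> S (a i) (g i) (c i) (h i) x
          = maximum (P_objective (a i) (g i)) (P_feasible N \<delta> S (c i) (h i) x) \<and>
        (\<forall>yb \<theta>. (yb, \<theta>) \<in> P_feasible N \<delta> S (c i) (h i) x \<longrightarrow>
           \<theta> > 0 \<and> yb /\<^sub>R \<theta> \<in> ?F) \<and>
        (\<forall>yb \<theta>. optimal_solution (P_objective (a i) (g i)) (P_feasible N \<delta> S (c i) (h i) x) (yb, \<theta>)
           \<longrightarrow> optimal_solution (?f i) ?F (yb /\<^sub>R \<theta>))"
    if i: "i \<in> {1..m}" for i
  proof (intro conjI allI impI)
    let ?P = "P_feasible N \<delta> S (c i) (h i) x"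
    let ?o = "P_objective (a i) (g i)"
    note P = P_feasible_eq_image[OF assms(5) pos[OF i]]
    note P_inv = P_feasibleE[OF assms(5) pos[OF i]]
    have transfer: "optimal_solution ?o ?P (charnes_cooper (c i) (h i) y) \<longleftrightarrow>
        optimal_solution (?f i) ?F y" if "y \<in> ?F" for y
      using optimal_solution_image[OF that, of ?o "charnes_cooper (c i) (h i)"]
      unfolding P P_objective_charnes_cooper .
    show ex: "\<exists>y. optimal_solution (?f i) ?F y"
      by (rule att[OF i])
    show "convex_max_problem ?o ?P"
      by (rule convex_max_problem_P[OF assms(2,5) pos[OF i]])
    show "\<exists>z. optimal_solution ?o ?P z"
      using ex transfer by (metis is_arg_max_def)
    show "f_tilde_i N \<delta> S (a i) (g i) (c i) (h i) x = maximum ?o ?P"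
      unfolding f_tilde_i_def P maximum_image P_objective_charnes_cooper ..
    show "0 < \<theta>" "yb /\<^sub>R \<theta> \<in> ?F" if "(yb, \<theta>) \<in> ?P" for yb \<theta>
      using P_inv[OF that] by simp_all
    show "optimal_solution (?f i) ?F (yb /\<^sub>R \<theta>)" if "optimal_solution ?o ?P (yb, \<theta>)" for yb \<theta>
    proof -
      have "(yb, \<theta>) \<in> ?P"
        using that by (simp add: is_arg_max_def)
      from P_inv[OF this] show ?thesis
        using transfer that by metis
    qed
  qed
  ultimately show ?thesis
    by blast
qed

end
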